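(* Let $(\mathcal{C},\mathcal{N})$ be an ex2-category. Then $(\mathcal{C},\mathcal{N})$ is a homological category if and only if for every null-sequence $X\xrightarrow{f}Y\xrightarrow{g}Z$ in $\mathcal{C}$ (i.e. every pair of composable morphisms with $gf\in\mathcal{N}$) the canonical morphism $m(f,g):H_{-}(f,g)\to H_{+}(f,g)$ from the left homology to the right homology is an isomorphism.
   Context: An ideal in a category $\mathcal{C}$ is a class $\mathcal{N}$ of morphisms such that every legitimate composite $hfg$ with $f\in\mathcal{N}$ lies in $\mathcal{N}$; morphisms in $\mathcal{N}$ are called null, and an object $A$ is null if $\mathrm{id}_A\in\mathcal{N}$. The ideal is closed if every null morphism factors through a null object. A kernel of $f:A\to B$ (with respect to $\mathcal{N}$) is a morphism $\ker f:\operatorname{Ker}f\to A$ with $f\ker f\in\mathcal{N}$ such that every $x$ with $fx\in\mathcal{N}$ factors uniquely as $x=(\ker f)x'$; the cokernel $\operatorname{coker}f:B\to\operatorname{Coker}f$ is defined dually. A morphism "is a kernel" (resp. "is a cokernel") if it is a kernel (resp. cokernel) of some morphism. $(\mathcal{C},\mathcal{N})$ is semiexact if $\mathcal{N}$ is a closed ideal and every morphism has a kernel and a cokernel. It is an ex2-category if moreover kernels are closed under composition and cokernels are closed under composition. An ex2-category is homological (in the sense of Grandis) if moreover: for every kernel $i:A\to B$ and cokernel $q:B\to C$ with $(\operatorname{coker}i)(\ker q)\in\mathcal{N}$ there exist a cokernel $\pi:A\to H$ and a kernel $\iota:H\to C$ with $qi=\iota\pi$. For a null-sequence $X\xrightarrow{f}Y\xrightarrow{g}Z$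 let $\sigma:X\to\operatorname{Ker}g$ be the unique morphism with $(\ker g)\sigma=f$ and $\tau:\operatorname{Coker}f\to Z$ the unique morphism with $\tau\operatorname{coker}f=g$. The left homology is $H_{-}(f,g)=\operatorname{Coker}\sigma$ and the right homology is $H_{+}(f,g)=\operatorname{Ker}\tau$. The morphism $m(f,g):H_{-}(f,g)\to H_{+}(f,g)$ is the unique morphism with $(\ker\tau)\,m(f,g)\operatorname{coker}\sigma=(\operatorname{coker}f)\ker g$. *)

theory Defs
  imports Main
begin

section \<open>Categories\<close>

text \<open>The composite \<open>g \<cdot>\<^bsub>C\<^esub> f\<close> means ``first \<open>f\<close>, then \<open>g\<close>''. Its value is constrained only
  when \<open>Cod C f = Dom C g\<close>, so every use below is guarded accordingly.\<close>

record ('o, 'm) cat =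
  Obj :: "'o set"
  Arr :: "'m set"
  Dom :: "'m \<Rightarrow> 'o"
  Cod :: "'m \<Rightarrow> 'o"
  Ident :: "'o \<Rightarrow> 'm"
  Comp :: "'m \<Rightarrow> 'm \<Rightarrow> 'm" (infixr "\<cdot>\<index>" 70)

definition Hom :: "('o, 'm) cat \<Rightarrow> 'o \<Rightarrow> 'o \<Rightarrow> 'm set" where
  "Hom C A B = {f \<in> Arr C. Dom C f = A \<and> Cod C f = B}"

locale category =
  fixes C :: "('o, 'm) cat" (structure)
  assumes Dom_in_Obj: "f \<in> Arr C \<Longrightarrow> Dom C f \<in> Obj C"
    and Cod_in_Obj: "f \<in> Arr C \<Longrightarrow> Cod C f \<in> Obj C"
    and Ident_in_Hom: "A \<in> Obj C \<Longrightarrow> Ident C A \<in> Hom C A A"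
    and Comp_in_Hom: "\<lbrakk>f \<in> Hom C A B; g \<in> Hom C B D\<rbrakk> \<Longrightarrow> g \<cdot> f \<in> Hom C A D"
    and Comp_Ident: "f \<in> Hom C A B \<Longrightarrow> f \<cdot> Ident C A = f"
    and Ident_Comp: "f \<in> Hom C A B \<Longrightarrow> Ident C B \<cdot> f = f"
    and Comp_assoc: "\<lbrakk>f \<in> Hom C A B; g \<in> Hom C B D; h \<in> Hom C D E\<rbrakk>
          \<Longrightarrow> (h \<cdot> g) \<cdot> f = h \<cdot> (g \<cdot> f)"

definition is_iso :: "('o, 'm) cat \<Rightarrow> 'o \<Rightarrow> 'o \<Rightarrow> 'm \<Rightarrow> bool" where
  "is_iso C A B f \<longleftrightarrow> f \<in> Hom C A B \<and>
     (\<exists>g \<in> Hom C B A. g \<cdot>\<^bsub>C\<^esub> f = Ident C A \<and> f \<cdot>\<^bsub>C\<^esub> g = Ident C B)"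


section \<open>Ideals, kernels and cokernels\<close>

definition is_ideal :: "('o, 'm) cat \<Rightarrow> 'm set \<Rightarrow> bool" where
  "is_ideal C N \<longleftrightarrow> N \<subseteq> Arr C \<and>
     (\<forall>f \<in> N. \<forall>g \<in> Arr C. \<forall>h \<in> Arr C.
        Cod C g = Dom C f \<and> Cod C f = Dom C h \<longrightarrow> h \<cdot>\<^bsub>C\<^esub> f \<cdot>\<^bsub>C\<^esub> g \<in> N)"

definition null_object :: "('o, 'm) cat \<Rightarrow> 'm set \<Rightarrow> 'o \<Rightarrow> bool" where
  "null_object C N A \<longleftrightarrow> A \<in> Obj C \<and> Ident C A \<in> N"

definition closed_ideal :: "('o, 'm) cat \<Rightarrow> 'm set \<Rightarrow> bool" where
  "closed_ideal C N \<longleftrightarrow> is_ideal C N \<and>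
     (\<forall>f \<in> N. \<exists>Z a b. null_object C N Z \<and>
        a \<in> Hom C (Dom C f) Z \<and> b \<in> Hom C Z (Cod C f) \<and> f = b \<cdot>\<^bsub>C\<^esub> a)"

definition is_kernel_of :: "('o, 'm) cat \<Rightarrow> 'm set \<Rightarrow> 'm \<Rightarrow> 'm \<Rightarrow> bool" where
  "is_kernel_of C N k f \<longleftrightarrow> f \<in> Arr C \<and> k \<in> Arr C \<and> Cod C k = Dom C f \<and> f \<cdot>\<^bsub>C\<^esub> k \<in> N \<and>
     (\<forall>x \<in> Arr C. Cod C x = Dom C f \<and> f \<cdot>\<^bsub>C\<^esub> x \<in> N \<longrightarrow>
        (\<exists>!x'. x' \<in> Hom C (Dom C x) (Dom C k) \<and> k \<cdot>\<^bsub>C\<^esub> x' = x))"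

definition is_cokernel_of :: "('o, 'm) cat \<Rightarrow> 'm set \<Rightarrow> 'm \<Rightarrow> 'm \<Rightarrow> bool" where
  "is_cokernel_of C N p f \<longleftrightarrow> f \<in> Arr C \<and> p \<in> Arr C \<and> Dom C p = Cod C f \<and> p \<cdot>\<^bsub>C\<^esub> f \<in> N \<and>
     (\<forall>x \<in> Arr C. Dom C x = Cod C f \<and> x \<cdot>\<^bsub>C\<^esub> f \<in> N \<longrightarrow>
        (\<exists>!x'. x' \<in> Hom C (Cod C p) (Cod C x) \<and> x' \<cdot>\<^bsub>C\<^esub> p = x))"

definition is_kernel :: "('o, 'm) cat \<Rightarrow> 'm set \<Rightarrow> 'm \<Rightarrow> bool" where
  "is_kernel C N k \<longleftrightarrow> (\<exists>f. is_kernel_of C N k f)"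

definition is_cokernel :: "('o, 'm) cat \<Rightarrow> 'm set \<Rightarrow> 'm \<Rightarrow> bool" where
  "is_cokernel C N p \<longleftrightarrow> (\<exists>f. is_cokernel_of C N p f)"

text \<open>Kernels and cokernels are unique only up to isomorphism; as usual, one of each is chosen
  for every morphism.\<close>

definition ker :: "('o, 'm) cat \<Rightarrow> 'm set \<Rightarrow> 'm \<Rightarrow> 'm" where
  "ker C N f = (SOME k. is_kernel_of C N k f)"

definition coker :: "('o, 'm) cat \<Rightarrow> 'm set \<Rightarrow> 'm \<Rightarrow> 'm" where
  "coker C N f = (SOME p. is_cokernel_of C N p f)"

definition Ker :: "('o, 'm) cat \<Rightarrow> 'm set \<Rightarrow> 'm \<Rightarrow> 'o" where
  "Ker C N f = Dom C (ker C N f)"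

definition Coker :: "('o, 'm) cat \<Rightarrow> 'm set \<Rightarrow> 'm \<Rightarrow> 'o" where
  "Coker C N f = Cod C (coker C N f)"


section \<open>Semiexact, ex2- and homological categories\<close>

locale semiexact_category = category C for C :: "('o, 'm) cat" (structure) +
  fixes N :: "'m set"
  assumes closed_ideal: "closed_ideal C N"
    and ex_kernel: "f \<in> Arr C \<Longrightarrow> \<exists>k. is_kernel_of C N k f"
    and ex_cokernel: "f \<in> Arr C \<Longrightarrow> \<exists>p. is_cokernel_of C N p f"

locale ex2_category = semiexact_category +
  assumes kernel_Comp:
      "\<lbrakk>is_kernel C N k; is_kernel C N l; Cod C k = Dom C l\<rbrakk> \<Longrightarrow> is_kernel C N (l \<cdot> k)"
    and cokernel_Comp:
      "\<lbrakk>is_cokernel C N p; is_cokernel C N q; Cod C p = Dom C q\<rbrakk> \<Longrightarrow> is_cokernel C N (q \<cdot> p)"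

locale homological_category = ex2_category +
  assumes subquotient:
    "\<lbrakk>is_kernel C N i; is_cokernel C N q; Cod C i = Dom C q; coker C N i \<cdot> ker C N q \<in> N\<rbrakk>
      \<Longrightarrow> \<exists>H \<pi> \<iota>. \<pi> \<in> Hom C (Dom C i) H \<and> is_cokernel C N \<pi> \<and>
                 \<iota> \<in> Hom C H (Cod C q) \<and> is_kernel C N \<iota> \<and> q \<cdot> i = \<iota> \<cdot> \<pi>"


section \<open>Left and right homology of a null-sequence\<close>

definition null_sequence :: "('o, 'm) cat \<Rightarrow> 'm set \<Rightarrow> 'm \<Rightarrow> 'm \<Rightarrow> bool" where
  "null_sequence C N f g \<longleftrightarrow>
     f \<in> Arr C \<and> g \<in> Arr C \<and> Cod C f = Dom C g \<and> g \<cdot>\<^bsub>C\<^esub> f \<in> N"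

definition sigma :: "('o, 'm) cat \<Rightarrow> 'm set \<Rightarrow> 'm \<Rightarrow> 'm \<Rightarrow> 'm" where
  "sigma C N f g = (THE s. s \<in> Hom C (Dom C f) (Ker C N g) \<and> ker C N g \<cdot>\<^bsub>C\<^esub> s = f)"

definition tau :: "('o, 'm) cat \<Rightarrow> 'm set \<Rightarrow> 'm \<Rightarrow> 'm \<Rightarrow> 'm" where
  "tau C N f g = (THE t. t \<in> Hom C (Coker C N f) (Cod C g) \<and> t \<cdot>\<^bsub>C\<^esub> coker C N f = g)"

definition left_homology :: "('o, 'm) cat \<Rightarrow> 'm set \<Rightarrow> 'm \<Rightarrow> 'm \<Rightarrow> 'o" where
  "left_homology C N f g = Coker C N (sigma C N f g)"

definition right_homology :: "('o, 'm) cat \<Rightarrow> 'm set \<Rightarrow> 'm \<Rightarrow> 'm \<Rightarrow> 'o" where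
  "right_homology C N f g = Ker C N (tau C N f g)"

definition canonical_map :: "('o, 'm) cat \<Rightarrow> 'm set \<Rightarrow> 'm \<Rightarrow> 'm \<Rightarrow> 'm" where
  "canonical_map C N f g =
     (THE m. m \<in> Hom C (left_homology C N f g) (right_homology C N f g) \<and>
        ker C N (tau C N f g) \<cdot>\<^bsub>C\<^esub> m \<cdot>\<^bsub>C\<^esub> coker C N (sigma C N f g)
          = coker C N f \<cdot>\<^bsub>C\<^esub> ker C N g)"


section \<open>The definite descriptions above are proper\<close>

text \<open>For every null-sequence in a semiexact category there is exactly one \<open>\<sigma>\<close>, one \<open>\<tau>\<close> and one
  \<open>m\<close> with the defining property.\<close>

context semiexact_category
begin

lemma ker_is_kernel_of: "f \<in> Arr C \<Longrightarrow> is_kernel_of C N (ker C N f) f"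
  unfolding ker_def by (rule someI_ex) (rule ex_kernel)

lemma coker_is_cokernel_of: "f \<in> Arr C \<Longrightarrow> is_cokernel_of C N (coker C N f) f"
  unfolding coker_def by (rule someI_ex) (rule ex_cokernel)

lemma ker_in_Hom: "f \<in> Hom C A B \<Longrightarrow> ker C N f \<in> Hom C (Ker C N f) A"
  using ker_is_kernel_of[of f] by (simp add: Hom_def Ker_def is_kernel_of_def)

lemma coker_in_Hom: "f \<in> Hom C A B \<Longrightarrow> coker C N f \<in> Hom C B (Coker C N f)"
  using coker_is_cokernel_of[of f] by (simp add: Hom_def Coker_def is_cokernel_of_def)

lemma ker_null: "f \<in> Hom C A B \<Longrightarrow> f \<cdot> ker C N f \<in> N"
  using ker_is_kernel_of[of f] by (simp add: Hom_def is_kernel_of_def)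

lemma coker_null: "f \<in> Hom C A B \<Longrightarrow> coker C N f \<cdot> f \<in> N"
  using coker_is_cokernel_of[of f] by (simp add: Hom_def is_cokernel_of_def)

lemma ker_factor:
  assumes "f \<in> Hom C A B" and "x \<in> Hom C X A" and "f \<cdot> x \<in> N"
  shows "\<exists>!x'. x' \<in> Hom C X (Ker C N f) \<and> ker C N f \<cdot> x' = x"
proof -
  have *: "f \<in> Arr C" "x \<in> Arr C" "Cod C x = Dom C f" "Dom C x = X"
    using assms(1,2) by (simp_all add: Hom_def)
  from ker_is_kernel_of[OF *(1)]
  have "\<forall>x \<in> Arr C. Cod C x = Dom C f \<and> f \<cdot> x \<in> N \<longrightarrow>
      (\<exists>!x'. x' \<in> Hom C (Dom C x) (Ker C N f) \<and> ker C N f \<cdot> x' = x)"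
    unfolding is_kernel_of_def Ker_def by (elim conjE)
  from this[rule_format, OF *(2)] show ?thesis using * assms(3) by simp
qed

lemma coker_factor:
  assumes "f \<in> Hom C A B" and "x \<in> Hom C B X" and "x \<cdot> f \<in> N"
  shows "\<exists>!x'. x' \<in> Hom C (Coker C N f) X \<and> x' \<cdot> coker C N f = x"
proof -
  have *: "f \<in> Arr C" "x \<in> Arr C" "Dom C x = Cod C f" "Cod C x = X"
    using assms(1,2) by (simp_all add: Hom_def)
  from coker_is_cokernel_of[OF *(1)]
  have "\<forall>x \<in> Arr C. Dom C x = Cod C f \<and> x \<cdot> f \<in> N \<longrightarrow>
      (\<exists>!x'. x' \<in> Hom C (Coker C N f) (Cod C x) \<and> x' \<cdot> coker C N f = x)"
    unfolding is_cokernel_of_def Coker_def by (elim conjE)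
  from this[rule_format, OF *(2)] show ?thesis using * assms(3) by simp
qed

lemma null_Comp:
  assumes "f \<in> N" "f \<in> Hom C A B"
  shows "h \<in> Hom C B D \<Longrightarrow> h \<cdot> f \<in> N" and "g \<in> Hom C D A \<Longrightarrow> f \<cdot> g \<in> N"
proof -
  have I: "\<And>h f g. \<lbrakk>f \<in> N; g \<in> Arr C; h \<in> Arr C; Cod C g = Dom C f; Cod C f = Dom C h\<rbrakk> \<Longrightarrow> h \<cdot> f \<cdot> g \<in> N"
    using closed_ideal by (auto simp: closed_ideal_def is_ideal_def)
  have AB: "A \<in> Obj C" "B \<in> Obj C"
    using assms Dom_in_Obj Cod_in_Obj by (auto simp: Hom_def)
  show "h \<cdot> f \<in> N" if "h \<in> Hom C B D"
    using I[OF assms(1), of "Ident C A" h] that assms Ident_in_Hom[OF AB(1)] Comp_Ident[of f A B]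
    by (auto simp: Hom_def)
  show "f \<cdot> g \<in> N" if g: "g \<in> Hom C D A"
  proof -
    have "Ident C B \<cdot> f \<cdot> g = f \<cdot> g" using Ident_Comp[OF Comp_in_Hom[OF g assms(2)]] .
    then show ?thesis
      using I[OF assms(1), of g "Ident C B"] g assms Ident_in_Hom[OF AB(2)] by (auto simp: Hom_def)
  qed
qed

text \<open>A morphism is null as soon as its composite with a cokernel is null.\<close>

lemma coker_reflects_null:
  assumes f: "f \<in> Hom C A B" and x: "x \<in> Hom C (Coker C N f) X" and n: "x \<cdot> coker C N f \<in> N"
  shows "x \<in> N"
proof -
  note c = coker_in_Hom[OF f]
  have xc: "x \<cdot> coker C N f \<in> Hom C B X" by (rule Comp_in_Hom[OF c x])
  obtain Z a b where Z: "null_object C N Z" and a: "a \<in> Hom C B Z" and b: "b \<in> Hom C Z X"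
    and e: "x \<cdot> coker C N f = b \<cdot> a"
  proof -
    have "Dom C (x \<cdot> coker C N f) = B" "Cod C (x \<cdot> coker C N f) = X"
      using xc by (simp_all add: Hom_def)
    then show thesis
      using closed_ideal n that unfolding closed_ideal_def by metis
  qed
  have ZN: "Ident C Z \<in> N" "Ident C Z \<in> Hom C Z Z"
    using Z Ident_in_Hom by (auto simp: null_object_def)
  have af: "a \<cdot> f \<in> Hom C A Z" by (rule Comp_in_Hom[OF f a])
  have "a \<cdot> f \<in> N" using null_Comp(2)[OF ZN af] Ident_Comp[OF af] by simp
  from coker_factor[OF f a this] obtain a' where a': "a' \<in> Hom C (Coker C N f) Z" "a' \<cdot> coker C N f = a"
    by auto
  have ba: "b \<cdot> a' \<in> Hom C (Coker C N f) X" by (rule Comp_in_Hom[OF a'(1) b])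
  have "(b \<cdot> a') \<cdot> coker C N f = x \<cdot> coker C N f" using Comp_assoc[OF c a'(1) b] a' e by simp
  then have "x = b \<cdot> a'"
    using coker_factor[OF f xc null_Comp(2)[OF n xc f]] x ba by blast
  moreover have "a' \<in> N" using null_Comp(2)[OF ZN a'(1)] Ident_Comp[OF a'(1)] by simp
  ultimately show ?thesis using null_Comp(1)[OF _ a'(1) b] by simp
qed

lemma ex1_sigma:
  assumes "null_sequence C N f g"
  shows "\<exists>!s. s \<in> Hom C (Dom C f) (Ker C N g) \<and> ker C N g \<cdot> s = f"
  by (rule ker_factor[of g _ "Cod C g"]) (use assms in \<open>auto simp: null_sequence_def Hom_def\<close>)

lemma ex1_tau:
  assumes "null_sequence C N f g"
  shows "\<exists>!t. t \<in> Hom C (Coker C N f) (Cod C g) \<and> t \<cdot> coker C N f = g"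
  by (rule coker_factor[of f "Dom C f"]) (use assms in \<open>auto simp: null_sequence_def Hom_def\<close>)

lemma ex1_canonical_map:
  assumes ns: "null_sequence C N f g"
  shows "\<exists>!m. m \<in> Hom C (left_homology C N f g) (right_homology C N f g) \<and>
        ker C N (tau C N f g) \<cdot> m \<cdot> coker C N (sigma C N f g) = coker C N f \<cdot> ker C N g"
proof -
  let ?s = "sigma C N f g" and ?t = "tau C N f g"
  obtain X Y Z where f: "f \<in> Hom C X Y" and g: "g \<in> Hom C Y Z"
    using ns by (auto simp: null_sequence_def Hom_def)
  have XZ: "X = Dom C f" "Z = Cod C g" using f g by (auto simp: Hom_def)
  have s: "?s \<in> Hom C X (Ker C N g)" "ker C N g \<cdot> ?s = f"
    using theI'[OF ex1_sigma[OF ns]] by (auto simp: sigma_def XZ)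
  have t: "?t \<in> Hom C (Coker C N f) Z" "?t \<cdot> coker C N f = g"
    using theI'[OF ex1_tau[OF ns]] by (auto simp: tau_def XZ)
  note k = ker_in_Hom[OF g] and c = coker_in_Hom[OF f]
  note cs = coker_in_Hom[OF s(1)] and kt = ker_in_Hom[OF t(1)]
  have ck: "coker C N f \<cdot> ker C N g \<in> Hom C (Ker C N g) (Coker C N f)" by (rule Comp_in_Hom[OF k c])
  have "(coker C N f \<cdot> ker C N g) \<cdot> ?s \<in> N"
    using Comp_assoc[OF s(1) k c] coker_null[OF f] s by simp
  from coker_factor[OF s(1) ck this] obtain u where
    u: "u \<in> Hom C (Coker C N ?s) (Coker C N f)" "u \<cdot> coker C N ?s = coker C N f \<cdot> ker C N g"
    and uu: "\<And>v. v \<in> Hom C (Coker C N ?s) (Coker C N f) \<Longrightarrow> v \<cdot> coker C N ?s = coker C N f \<cdot> ker C N g \<Longrightarrow> v = u"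
    by auto
  have "(?t \<cdot> u) \<cdot> coker C N ?s = g \<cdot> ker C N g"
    using Comp_assoc[OF cs u(1) t(1)] Comp_assoc[OF k c t(1)] u t by simp
  then have "?t \<cdot> u \<in> N"
    using coker_reflects_null[OF s(1) Comp_in_Hom[OF u(1) t(1)]] ker_null[OF g] by simp
  from ker_factor[OF t(1) u(1) this] obtain m where
    m: "m \<in> Hom C (Coker C N ?s) (Ker C N ?t)" "ker C N ?t \<cdot> m = u"
    and mm: "\<And>v. v \<in> Hom C (Coker C N ?s) (Ker C N ?t) \<Longrightarrow> ker C N ?t \<cdot> v = u \<Longrightarrow> v = m"
    by auto
  show ?thesis unfolding left_homology_def right_homology_def
  proof (rule ex1I[of _ m], goal_cases)
    case 1 show ?case using m u Comp_assoc[OF cs m(1) kt] by simp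
  next
    case (2 v)
    then have v: "v \<in> Hom C (Coker C N ?s) (Ker C N ?t)" by simp
    show ?case using mm[OF v] uu[OF Comp_in_Hom[OF v kt]] 2 Comp_assoc[OF cs v kt] by simp
  qed
qed

end

end

(* Put i = ker g and q = coker f. If q i = \<iota> \<pi> with a cokernel \<pi> and a kernel \<iota>, then \<pi> is
   coker \<sigma> up to isomorphism: the composite j of i with the normal closure of \<sigma> is a kernel,
   because kernels compose, and f = i \<sigma> factors through j; hence so does the normal closure
   ker q of f, which makes (coker \<sigma>)(ker \<pi>) null. Dually \<iota> is ker \<tau> up to isomorphism, so m(f,g)
   is invertible. Conversely, for a kernel i and a cokernel q with (coker i)(ker q) null, the
   sequence (ker q, coker i) is null, and its m supplies the factorization of q i. *)
theory Submission
  imports Defs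
begin

section \<open>Duality\<close>

text \<open>The carriers and \<open>N\<close> stay the same, so each result on cokernels yields its
  dual for kernels by instantiating at \<open>opp C\<close> and rewriting with the simp rules
  below.\<close>

definition opp :: "('o, 'm) cat \<Rightarrow> ('o, 'm) cat" where
  "opp C = \<lparr>Obj = Obj C, Arr = Arr C, Dom = Cod C, Cod = Dom C, Ident = Ident C,
     Comp = (\<lambda>g f. f \<cdot>\<^bsub>C\<^esub> g)\<rparr>"

lemma opp_sel [simp]:
  "Obj (opp C) = Obj C" "Arr (opp C) = Arr C" "Dom (opp C) = Cod C" "Cod (opp C) = Dom C"
  "Ident (opp C) = Ident C" "g \<cdot>\<^bsub>opp C\<^esub> f = f \<cdot>\<^bsub>C\<^esub> g"
  by (simp_all add: opp_def)

lemma Hom_opp [simp]: "Hom (opp C) A B = Hom C B A"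
  by (auto simp: Hom_def)

lemma is_iso_opp [simp]: "is_iso (opp C) A B f \<longleftrightarrow> is_iso C B A f"
  by (auto simp: is_iso_def)

lemma is_kernel_of_opp [simp]: "is_kernel_of (opp C) N k f \<longleftrightarrow> is_cokernel_of C N k f"
  by (auto simp: is_kernel_of_def is_cokernel_of_def)

lemma is_cokernel_of_opp [simp]: "is_cokernel_of (opp C) N k f \<longleftrightarrow> is_kernel_of C N k f"
  by (auto simp: is_kernel_of_def is_cokernel_of_def)

lemma kernel_opp [simp]:
  "is_kernel (opp C) N k \<longleftrightarrow> is_cokernel C N k" "is_cokernel (opp C) N k \<longleftrightarrow> is_kernel C N k"
  "ker (opp C) N f = coker C N f" "coker (opp C) N f = ker C N f"
  "Ker (opp C) N f = Coker C N f" "Coker (opp C) N f = Ker C N f"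
  by (simp_all add: is_kernel_def is_cokernel_def ker_def coker_def Ker_def Coker_def)

text \<open>Reversing arrows turns X -> Y -> Z into Z -> Y -> X; hence the two arguments trade
  places.\<close>

lemma homology_opp [simp]:
  "sigma (opp C) N g f = tau C N f g" "left_homology (opp C) N g f = right_homology C N f g"
  by (simp_all add: sigma_def tau_def left_homology_def right_homology_def)

lemma null_sequence_opp [simp]: "null_sequence (opp C) N g f \<longleftrightarrow> null_sequence C N f g"
  by (auto simp: null_sequence_def)

section \<open>Self-duality of the axioms\<close>

lemma (in category) category_opp: "category (opp C)"
  by unfold_locales
    (use Dom_in_Obj Cod_in_Obj Ident_in_Hom Comp_in_Hom Comp_Ident Ident_Comp Comp_assoc in auto)

lemma (in semiexact_category) semiexact_category_opp: "semiexact_category (opp C) N"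
proof -
  interpret op: category "opp C" by (rule category_opp)
  have sub: "N \<subseteq> Arr C"
    using closed_ideal by (simp add: closed_ideal_def is_ideal_def)
  \<comment> \<open>\<open>is_ideal\<close> brackets to the right, and in \<open>opp C\<close> this
    becomes bracketing to the left; two one-sided absorptions give that form.\<close>
  have comp: "(h \<cdot> f) \<cdot> g \<in> N"
    if f: "f \<in> N" and g: "g \<in> Arr C" "Cod C g = Dom C f" and h: "h \<in> Arr C" "Cod C f = Dom C h"
    for f g h
  proof -
    have H: "f \<in> Hom C (Dom C f) (Cod C f)" "g \<in> Hom C (Dom C g) (Dom C f)"
      "h \<in> Hom C (Cod C f) (Cod C h)"
      using f g h sub by (auto simp: Hom_def)
    show ?thesis
      using null_Comp(2)[OF null_Comp(1)[OF f H(1,3)] Comp_in_Hom[OF H(1,3)] H(2)] .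
  qed
  have "is_ideal (opp C) N"
    using sub comp by (auto simp: is_ideal_def)
  moreover have "\<exists>Z a b. null_object C N Z \<and> a \<in> Hom C Z (Cod C f) \<and> b \<in> Hom C (Dom C f) Z \<and> f = a \<cdot> b"
    if "f \<in> N" for f
    using closed_ideal that unfolding closed_ideal_def by metis
  ultimately have "closed_ideal (opp C) N"
    by (simp add: closed_ideal_def null_object_def)
  then show ?thesis
    by unfold_locales (use ex_kernel ex_cokernel in auto)
qed

lemma (in ex2_category) ex2_category_opp: "ex2_category (opp C) N"
proof -
  interpret op: semiexact_category "opp C" N by (rule semiexact_category_opp)
  show ?thesis
    by unfold_locales (use kernel_Comp cokernel_Comp in auto)
qed


section \<open>Kernels and cokernels\<close>

lemma (in category) is_iso_Comp:
  assumes "is_iso C A B u" "is_iso C B D v"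
  shows "is_iso C A D (v \<cdot> u)"
proof -
  obtain u' where u: "u \<in> Hom C A B" "u' \<in> Hom C B A"
    "u' \<cdot> u = Ident C A" "u \<cdot> u' = Ident C B"
    using assms(1) by (auto simp: is_iso_def)
  obtain v' where v: "v \<in> Hom C B D" "v' \<in> Hom C D B"
    "v' \<cdot> v = Ident C B" "v \<cdot> v' = Ident C D"
    using assms(2) by (auto simp: is_iso_def)
  have vu: "v \<cdot> u \<in> Hom C A D" "u' \<cdot> v' \<in> Hom C D A"
    using Comp_in_Hom u v by blast+
  have "(u' \<cdot> v') \<cdot> (v \<cdot> u) = u' \<cdot> ((v' \<cdot> v) \<cdot> u)"
    using Comp_assoc[OF vu(1) v(2) u(2)] Comp_assoc[OF u(1) v(1) v(2)] by simp
  moreover have "(v \<cdot> u) \<cdot> (u' \<cdot> v') = v \<cdot> ((u \<cdot> u') \<cdot> v')"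
    using Comp_assoc[OF vu(2) u(1) v(1)] Comp_assoc[OF v(2) u(2) u(1)] by simp
  ultimately show ?thesis
    using u v vu Ident_Comp[OF u(1)] Ident_Comp[OF v(2)] by (auto simp: is_iso_def)
qed

context semiexact_category
begin

text \<open>The counterpart of \<open>coker_factor\<close> for an arbitrary cokernel instead of the
  chosen one.\<close>

lemma is_cokernel_of_factor:
  assumes p: "is_cokernel_of C N p f" "p \<in> Hom C B Q" and x: "x \<in> Hom C B X" "x \<cdot> f \<in> N"
  shows "\<exists>!x'. x' \<in> Hom C Q X \<and> x' \<cdot> p = x"
proof -
  have *: "x \<in> Arr C" "Dom C x = Cod C f" "Cod C x = X" "Cod C p = Q"
    using p x by (simp_all add: is_cokernel_of_def Hom_def)
  from p(1) have "\<forall>x \<in> Arr C. Dom C x = Cod C f \<and> x \<cdot> f \<in> N \<longrightarrow>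
      (\<exists>!x'. x' \<in> Hom C (Cod C p) (Cod C x) \<and> x' \<cdot> p = x)"
    unfolding is_cokernel_of_def by (elim conjE)
  from this[rule_format, OF *(1)] show ?thesis using * x(2) by simp
qed

text \<open>If \<open>p\<close> is a cokernel of \<open>f\<close>, then \<open>x\<close> and
  \<open>y\<close> both factor the map \<open>x \<cdot> p\<close>, which is null on
  \<open>f\<close>; uniqueness of the factorization identifies them.\<close>

lemma is_cokernel_epi:
  assumes p: "is_cokernel C N p" "p \<in> Hom C B Q" and x: "x \<in> Hom C Q X" and y: "y \<in> Hom C Q X"
    and e: "x \<cdot> p = y \<cdot> p"
  shows "x = y"
proof -
  obtain f where f: "is_cokernel_of C N p f" using p by (auto simp: is_cokernel_def)
  then have fH: "f \<in> Hom C (Dom C f) B" and pf: "p \<cdot> f \<in> N"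
    using p by (auto simp: is_cokernel_of_def Hom_def)
  have xp: "x \<cdot> p \<in> Hom C B X" by (rule Comp_in_Hom[OF p(2) x])
  have "(x \<cdot> p) \<cdot> f \<in> N"
    using Comp_assoc[OF fH p(2) x] null_Comp(1)[OF pf Comp_in_Hom[OF fH p(2)] x] by simp
  from is_cokernel_of_factor[OF f p(2) xp this] show ?thesis using x y e by metis
qed

text \<open>A cokernel of \<open>f\<close> is also a cokernel of its own kernel: \<open>f\<close>
  factors through \<open>ker C N p\<close>, so whatever is null on the kernel is null on
  \<open>f\<close>. This removes the reference to \<open>f\<close>.\<close>

lemma is_cokernel_factor:
  assumes p: "is_cokernel C N p" "p \<in> Hom C B Q" and x: "x \<in> Hom C B X"
    and n: "x \<cdot> ker C N p \<in> N"
  obtains x' where "x' \<in> Hom C Q X" "x' \<cdot> p = x"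
proof -
  obtain f where f: "is_cokernel_of C N p f" using p by (auto simp: is_cokernel_def)
  then have fH: "f \<in> Hom C (Dom C f) B" and pf: "p \<cdot> f \<in> N"
    using p by (auto simp: is_cokernel_of_def Hom_def)
  note k = ker_in_Hom[OF p(2)]
  obtain f' where f': "f' \<in> Hom C (Dom C f) (Ker C N p)" "ker C N p \<cdot> f' = f"
    using ker_factor[OF p(2) fH pf] by auto
  have "x \<cdot> f \<in> N"
    using null_Comp(2)[OF n Comp_in_Hom[OF k x] f'(1)] Comp_assoc[OF f'(1) k x] f' by simp
  from is_cokernel_of_factor[OF f p(2) x this] show thesis using that by blast
qed

lemma is_cokernel_coker: "f \<in> Hom C A B \<Longrightarrow> is_cokernel C N (coker C N f)"
  using coker_is_cokernel_of[of f] by (auto simp: is_cokernel_def Hom_def)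

text \<open>The null condition gives a map \<open>v\<close> back with
  \<open>v \<cdot> q = p\<close>; since \<open>p\<close> and \<open>q\<close> are epi,
  \<open>u\<close> and \<open>v\<close> are mutually inverse.\<close>

lemma cokernel_comparison_iso:
  assumes p: "is_cokernel C N p" "p \<in> Hom C B P" and q: "is_cokernel C N q" "q \<in> Hom C B Q"
    and u: "u \<in> Hom C P Q" "u \<cdot> p = q" and n: "p \<cdot> ker C N q \<in> N"
  shows "is_iso C P Q u"
proof -
  obtain v where v: "v \<in> Hom C Q P" "v \<cdot> q = p"
    using is_cokernel_factor[OF q p(2) n] .
  have I: "Ident C P \<in> Hom C P P" "Ident C Q \<in> Hom C Q Q"
    using u Dom_in_Obj Cod_in_Obj Ident_in_Hom by (auto simp: Hom_def)
  have "(v \<cdot> u) \<cdot> p = Ident C P \<cdot> p"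
    using Comp_assoc[OF p(2) u(1) v(1)] u v Ident_Comp[OF p(2)] by simp
  then have vu: "v \<cdot> u = Ident C P"
    using is_cokernel_epi[OF p Comp_in_Hom[OF u(1) v(1)] I(1)] by simp
  have "(u \<cdot> v) \<cdot> q = Ident C Q \<cdot> q"
    using Comp_assoc[OF q(2) v(1) u(1)] u v Ident_Comp[OF q(2)] by simp
  then have "u \<cdot> v = Ident C Q"
    using is_cokernel_epi[OF q Comp_in_Hom[OF v(1) u(1)] I(2)] by simp
  with vu show ?thesis using u v by (auto simp: is_iso_def)
qed

text \<open>Lets an arbitrary cokernel be replaced by the chosen cokernel of its kernel.\<close>

lemma is_cokernel_iso_coker_ker:
  assumes p: "is_cokernel C N p" "p \<in> Hom C B Q"
  obtains b where "is_iso C (Coker C N (ker C N p)) Q b" "b \<cdot> coker C N (ker C N p) = p"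
proof -
  note k = ker_in_Hom[OF p(2)]
  obtain b where b: "b \<in> Hom C (Coker C N (ker C N p)) Q" "b \<cdot> coker C N (ker C N p) = p"
    using coker_factor[OF k p(2) ker_null[OF p(2)]] by auto
  from cokernel_comparison_iso[OF is_cokernel_coker[OF k] coker_in_Hom[OF k] p b coker_null[OF k]]
  show thesis using that b(2) by blast
qed

text \<open>\<open>coker_reflects_null\<close> covers chosen cokernels only; the isomorphism with
  \<open>coker C N (ker C N p)\<close> carries it over to \<open>p\<close>.\<close>

lemma is_cokernel_reflects_null:
  assumes p: "is_cokernel C N p" "p \<in> Hom C B Q" and x: "x \<in> Hom C Q X" and n: "x \<cdot> p \<in> N"
  shows "x \<in> N"
proof -
  note k = ker_in_Hom[OF p(2)]
  obtain b where "is_iso C (Coker C N (ker C N p)) Q b" and bp: "b \<cdot> coker C N (ker C N p) = p"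
    using is_cokernel_iso_coker_ker[OF p] .
  then obtain b' where b: "b \<in> Hom C (Coker C N (ker C N p)) Q"
    and b': "b' \<in> Hom C Q (Coker C N (ker C N p))" "b \<cdot> b' = Ident C Q"
    by (auto simp: is_iso_def)
  have xb: "x \<cdot> b \<in> Hom C (Coker C N (ker C N p)) X" by (rule Comp_in_Hom[OF b x])
  have "(x \<cdot> b) \<cdot> coker C N (ker C N p) \<in> N"
    using Comp_assoc[OF coker_in_Hom[OF k] b x] bp n by simp
  from coker_reflects_null[OF k xb this] have "(x \<cdot> b) \<cdot> b' \<in> N"
    using null_Comp(2) xb b'(1) by blast
  then show ?thesis using Comp_assoc[OF b'(1) b x] b' Comp_Ident[OF x] by simp
qed

text \<open>Every \<open>x\<close> out of the domain factors uniquely as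
  \<open>(x \<cdot> v) \<cdot> u\<close>, so \<open>u\<close> is a cokernel of its own kernel.
  Closure under composition can then absorb isomorphisms.\<close>

lemma iso_is_cokernel:
  assumes "is_iso C A B u"
  shows "is_cokernel C N u"
proof -
  from assms obtain v where u: "u \<in> Hom C A B" and v: "v \<in> Hom C B A"
    and vu: "v \<cdot> u = Ident C A" and uv: "u \<cdot> v = Ident C B"
    by (auto simp: is_iso_def)
  note k = ker_in_Hom[OF u]
  have "\<exists>!x'. x' \<in> Hom C B X \<and> x' \<cdot> u = x" if x: "x \<in> Hom C A X" for x X
  proof (rule ex1I[of _ "x \<cdot> v"])
    show "x \<cdot> v \<in> Hom C B X \<and> (x \<cdot> v) \<cdot> u = x"
      using Comp_in_Hom[OF v x] Comp_assoc[OF u v x] vu Comp_Ident[OF x] by simp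
  next
    fix y assume y: "y \<in> Hom C B X \<and> y \<cdot> u = x"
    then show "y = x \<cdot> v"
      using Comp_assoc[OF v u, of y X] uv Comp_Ident[of y B X] by simp
  qed
  then have "\<forall>x \<in> Arr C. Dom C x = Cod C (ker C N u) \<and> x \<cdot> ker C N u \<in> N \<longrightarrow>
      (\<exists>!x'. x' \<in> Hom C (Cod C u) (Cod C x) \<and> x' \<cdot> u = x)"
    using u k by (simp add: Hom_def)
  then have "is_cokernel_of C N u (ker C N u)"
    using u k ker_null[OF u] by (simp add: is_cokernel_of_def Hom_def)
  then show ?thesis by (auto simp: is_cokernel_def)
qed

interpretation op: semiexact_category "opp C" N by (rule semiexact_category_opp)

text \<open>The preceding lemmas read in the opposite category.\<close>

lemmas is_kernel_mono = op.is_cokernel_epi[simplified]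
  and is_kernel_factor = op.is_cokernel_factor[simplified]
  and is_kernel_ker = op.is_cokernel_coker[simplified]
  and is_kernel_iso_ker_coker = op.is_cokernel_iso_coker_ker[simplified]
  and is_kernel_reflects_null = op.is_cokernel_reflects_null[simplified]
  and iso_is_kernel = op.iso_is_cokernel[simplified]

section \<open>Defining equations of \<open>sigma\<close>, \<open>tau\<close> and
  \<open>canonical_map\<close>\<close>

lemma sigma_in_Hom:
  assumes "null_sequence C N f g"
  shows "sigma C N f g \<in> Hom C (Dom C f) (Ker C N g)" "ker C N g \<cdot> sigma C N f g = f"
  using theI'[OF ex1_sigma[OF assms]] by (auto simp: sigma_def)

lemma tau_in_Hom:
  assumes "null_sequence C N f g"
  shows "tau C N f g \<in> Hom C (Coker C N f) (Cod C g)" "tau C N f g \<cdot> coker C N f = g"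
  using theI'[OF ex1_tau[OF assms]] by (auto simp: tau_def)

lemma canonical_map_eqI:
  assumes "null_sequence C N f g"
    and "m \<in> Hom C (left_homology C N f g) (right_homology C N f g)"
    and "ker C N (tau C N f g) \<cdot> m \<cdot> coker C N (sigma C N f g) = coker C N f \<cdot> ker C N g"
  shows "canonical_map C N f g = m"
  unfolding canonical_map_def by (rule the1_equality[OF ex1_canonical_map]) (use assms in auto)

lemma canonical_map_factorization:
  assumes "null_sequence C N f g"
  shows "ker C N (tau C N f g) \<cdot> canonical_map C N f g \<cdot> coker C N (sigma C N f g)
    = coker C N f \<cdot> ker C N g"
  using theI'[OF ex1_canonical_map[OF assms]] by (simp add: canonical_map_def)

text \<open>The normal closure of \<open>f\<close> is the least kernel through which
  \<open>f\<close> factors: \<open>coker C N j\<close> is null on \<open>f\<close>, so it factors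
  through \<open>coker C N f\<close> and is null on the normal closure, which therefore lifts along
  \<open>j\<close>.\<close>

lemma ker_coker_least:
  assumes j: "is_kernel C N j" "j \<in> Hom C J B" and s: "s \<in> Hom C A J" and f: "j \<cdot> s = f"
  obtains y where "y \<in> Hom C (Ker C N (coker C N f)) J" "j \<cdot> y = ker C N (coker C N f)"
proof -
  have fH: "f \<in> Hom C A B" using Comp_in_Hom[OF s j(2)] f by simp
  note c = coker_in_Hom[OF fH] and d = coker_in_Hom[OF j(2)]
  note k = ker_in_Hom[OF c]
  have "coker C N j \<cdot> f \<in> N"
    using null_Comp(2)[OF coker_null[OF j(2)] Comp_in_Hom[OF j(2) d] s] Comp_assoc[OF s j(2) d] f
    by simp
  from coker_factor[OF fH d this] obtain t where
    t: "t \<in> Hom C (Coker C N f) (Coker C N j)" "t \<cdot> coker C N f = coker C N j"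
    by auto
  have "coker C N j \<cdot> ker C N (coker C N f) \<in> N"
    using null_Comp(1)[OF ker_null[OF c] Comp_in_Hom[OF k c] t(1)] Comp_assoc[OF k c t(1)] t by simp
  from is_kernel_factor[OF j k this] that show thesis by blast
qed

end


section \<open>Homology\<close>

text \<open>Any cokernel-kernel factorization of (coker f)(ker g) has the left homology as its
  middle object. The comparison \<open>u\<close> exists because \<open>\<pi>\<close> is null on
  \<sigma>; it is invertible once (coker \<sigma>)(ker \<pi>) is null.\<close>

lemma (in ex2_category) left_homology_iso:
  assumes ns: "null_sequence C N f g"
    and \<pi>: "is_cokernel C N \<pi>" "\<pi> \<in> Hom C (Ker C N g) H"
    and \<iota>: "is_kernel C N \<iota>" "\<iota> \<in> Hom C H (Coker C N f)"
    and e: "\<iota> \<cdot> \<pi> = coker C N f \<cdot> ker C N g"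
  obtains u where "is_iso C (left_homology C N f g) H u" "u \<cdot> coker C N (sigma C N f g) = \<pi>"
proof -
  let ?i = "ker C N g" and ?q = "coker C N f" and ?s = "sigma C N f g"
  obtain X Y Z where f: "f \<in> Hom C X Y" and g: "g \<in> Hom C Y Z" and X: "Dom C f = X"
    using ns by (auto simp: null_sequence_def Hom_def)
  note s = sigma_in_Hom[OF ns, unfolded X]
  note i = ker_in_Hom[OF g] and q = coker_in_Hom[OF f] and p = coker_in_Hom[OF s(1)]
  note k\<pi> = ker_in_Hom[OF \<pi>(2)] and kq = ker_in_Hom[OF q]
  let ?n = "ker C N (coker C N ?s)"
  note n = ker_in_Hom[OF p]
  \<comment> \<open>Composing with \<open>\<iota>\<close> gives (coker f) f, which is null, and
    kernels reflect null morphisms.\<close>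
  have ps: "\<pi> \<cdot> ?s \<in> N"
  proof (rule is_kernel_reflects_null[OF \<iota> Comp_in_Hom[OF s(1) \<pi>(2)]])
    show "\<iota> \<cdot> \<pi> \<cdot> ?s \<in> N"
      using Comp_assoc[OF s(1) \<pi>(2) \<iota>(2)] Comp_assoc[OF s(1) i q] e s(2) coker_null[OF f] by simp
  qed
  obtain u where u: "u \<in> Hom C (Coker C N ?s) H" "u \<cdot> coker C N ?s = \<pi>"
    using coker_factor[OF s(1) \<pi>(2) ps] by auto

  obtain s' where s': "s' \<in> Hom C X (Ker C N (coker C N ?s))" "?n \<cdot> s' = ?s"
    using ker_factor[OF p s(1) coker_null[OF s(1)]] by auto
  \<comment> \<open>Closure of kernels under composition enters here; it makes
    \<open>ker_coker_least\<close> applicable to \<open>?i \<cdot> ?n\<close>.\<close>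
  have j: "is_kernel C N (?i \<cdot> ?n)" "?i \<cdot> ?n \<in> Hom C (Ker C N (coker C N ?s)) Y"
    using kernel_Comp[OF is_kernel_ker[OF p] is_kernel_ker[OF g]] n i Comp_in_Hom[OF n i]
    by (auto simp: Hom_def)
  have js: "(?i \<cdot> ?n) \<cdot> s' = f" using Comp_assoc[OF s'(1) n i] s' s by simp
  obtain y where y: "y \<in> Hom C (Ker C N ?q) (Ker C N (coker C N ?s))" "(?i \<cdot> ?n) \<cdot> y = ker C N ?q"
    using ker_coker_least[OF j s'(1) js] .

  \<comment> \<open>Since \<open>?q \<cdot> ?i\<close> equals \<open>\<iota> \<cdot> \<pi>\<close>,
    the map \<open>?i \<cdot> ker C N \<pi>\<close> lifts to \<open>ker C N ?q\<close>, and via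
    \<open>y\<close> further to \<open>?i \<cdot> ?n\<close>.\<close>
  have "?q \<cdot> ?i \<cdot> ker C N \<pi> \<in> N"
    using null_Comp(1)[OF ker_null[OF \<pi>(2)] Comp_in_Hom[OF k\<pi> \<pi>(2)] \<iota>(2)]
      Comp_assoc[OF k\<pi> \<pi>(2) \<iota>(2)] Comp_assoc[OF k\<pi> i q] e by simp
  from ker_factor[OF q Comp_in_Hom[OF k\<pi> i] this] obtain z where
    z: "z \<in> Hom C (Ker C N \<pi>) (Ker C N ?q)" "ker C N ?q \<cdot> z = ?i \<cdot> ker C N \<pi>"
    by auto
  note yz = Comp_in_Hom[OF z(1) y(1)]
  have "?i \<cdot> ?n \<cdot> y \<cdot> z = ?i \<cdot> ker C N \<pi>"
    using Comp_assoc[OF z(1) y(1) j(2)] Comp_assoc[OF yz n i] y z by simp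
  \<comment> \<open>Cancelling the mono \<open>?i\<close> puts \<open>ker C N \<pi>\<close> inside
    \<open>?n\<close>, the kernel of coker \<sigma>.\<close>
  then have "?n \<cdot> y \<cdot> z = ker C N \<pi>"
    using is_kernel_mono[OF is_kernel_ker[OF g] i Comp_in_Hom[OF yz n] k\<pi>] by simp
  then have "coker C N ?s \<cdot> ker C N \<pi> \<in> N"
    using null_Comp(2)[OF ker_null[OF p] Comp_in_Hom[OF n p] yz] Comp_assoc[OF yz n p] by simp
  from cokernel_comparison_iso[OF is_cokernel_coker[OF s(1)] p \<pi> u this] u(2) show thesis
    using that by (simp add: left_homology_def)
qed

text \<open>The left-hand result in the opposite category, for the reversed sequence and with
  \<open>\<pi>\<close> and \<open>\<iota>\<close> exchanged; its isomorphism then starts at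
  \<open>H\<close>, so it composes with that of \<open>left_homology_iso\<close>.\<close>

lemma (in ex2_category) right_homology_iso:
  assumes "null_sequence C N f g"
    and "is_cokernel C N \<pi>" "\<pi> \<in> Hom C (Ker C N g) H"
    and "is_kernel C N \<iota>" "\<iota> \<in> Hom C H (Coker C N f)"
    and "\<iota> \<cdot> \<pi> = coker C N f \<cdot> ker C N g"
  obtains w where "is_iso C H (right_homology C N f g) w" "ker C N (tau C N f g) \<cdot> w = \<iota>"
proof -
  interpret op: ex2_category "opp C" N by (rule ex2_category_opp)
  show thesis
    by (rule op.left_homology_iso[simplified, OF assms(1,4,5,2,3,6) that])
qed

lemma (in homological_category) canonical_map_iso:
  assumes ns: "null_sequence C N f g"
  shows "is_iso C (left_homology C N f g) (right_homology C N f g) (canonical_map C N f g)"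
proof -
  let ?i = "ker C N g" and ?q = "coker C N f" and ?s = "sigma C N f g" and ?t = "tau C N f g"
  obtain X Y Z where f: "f \<in> Hom C X Y" and g: "g \<in> Hom C Y Z"
    and XZ: "Dom C f = X" "Cod C g = Z"
    using ns by (auto simp: null_sequence_def Hom_def)
  note s = sigma_in_Hom[OF ns, unfolded XZ] and t = tau_in_Hom[OF ns, unfolded XZ]
  note i = ker_in_Hom[OF g] and q = coker_in_Hom[OF f]
  note kq = ker_in_Hom[OF q] and ci = coker_in_Hom[OF i]
  \<comment> \<open>Towards the hypothesis of \<open>subquotient\<close>: \<open>g\<close> factors
    through \<open>?q\<close> by \<tau>, so it is null on \<open>ker C N ?q\<close>, which hence
    lifts along \<open>?i\<close> and is annihilated by coker \<open>?i\<close>.\<close>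
  have "g \<cdot> ker C N ?q \<in> N"
    using null_Comp(1)[OF ker_null[OF q] Comp_in_Hom[OF kq q] t(1)] Comp_assoc[OF kq q t(1)] t by simp
  from ker_factor[OF g kq this] obtain x where
    x: "x \<in> Hom C (Ker C N ?q) (Ker C N g)" "?i \<cdot> x = ker C N ?q"
    by auto
  have "coker C N ?i \<cdot> ker C N ?q \<in> N"
    using null_Comp(2)[OF coker_null[OF i] Comp_in_Hom[OF i ci] x(1)] Comp_assoc[OF x(1) i ci] x by simp
  moreover have "Cod C ?i = Dom C ?q" "Dom C ?i = Ker C N g" "Cod C ?q = Coker C N f"
    using i q by (auto simp: Hom_def)
  ultimately obtain H \<pi> \<iota> where \<pi>: "is_cokernel C N \<pi>" "\<pi> \<in> Hom C (Ker C N g) H"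
    and \<iota>: "is_kernel C N \<iota>" "\<iota> \<in> Hom C H (Coker C N f)" and e: "\<iota> \<cdot> \<pi> = ?q \<cdot> ?i"
    using subquotient[OF is_kernel_ker[OF g] is_cokernel_coker[OF f]] by metis
  obtain u where u: "is_iso C (left_homology C N f g) H u" "u \<cdot> coker C N ?s = \<pi>"
    using left_homology_iso[OF ns \<pi> \<iota> e] .
  obtain w where w: "is_iso C H (right_homology C N f g) w" "ker C N ?t \<cdot> w = \<iota>"
    using right_homology_iso[OF ns \<pi> \<iota> e] .
  have iso: "is_iso C (left_homology C N f g) (right_homology C N f g) (w \<cdot> u)"
    by (rule is_iso_Comp[OF u(1) w(1)])
  have uH: "u \<in> Hom C (Coker C N ?s) H" and wH: "w \<in> Hom C H (Ker C N ?t)"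
    using u w by (auto simp: is_iso_def left_homology_def right_homology_def)
  note cs = coker_in_Hom[OF s(1)] and kt = ker_in_Hom[OF t(1)]
  \<comment> \<open>The composite of the two comparisons satisfies the equation that determines
    m(f,g).\<close>
  have "ker C N ?t \<cdot> (w \<cdot> u) \<cdot> coker C N ?s = ?q \<cdot> ?i"
    using Comp_assoc[OF cs uH wH] Comp_assoc[OF \<pi>(2) wH kt] u(2) w(2) e by simp
  with iso have "canonical_map C N f g = w \<cdot> u"
    by (intro canonical_map_eqI[OF ns]) (auto simp: is_iso_def)
  with iso show ?thesis by simp
qed

lemma (in ex2_category) homological_if_canonical_map_iso:
  assumes iso: "\<And>f g. null_sequence C N f g \<Longrightarrow>
    is_iso C (left_homology C N f g) (right_homology C N f g) (canonical_map C N f g)"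
  shows "homological_category C N"
proof unfold_locales
  fix i q
  assume ik: "is_kernel C N i" and qc: "is_cokernel C N q" and iq: "Cod C i = Dom C q"
    and null: "coker C N i \<cdot> ker C N q \<in> N"
  obtain A B where i: "i \<in> Hom C A B" and A: "Dom C i = A"
    using ik by (auto simp: is_kernel_def is_kernel_of_def Hom_def)
  obtain D where q: "q \<in> Hom C B D" and D: "Cod C q = D"
    using qc i iq by (auto simp: is_cokernel_def is_cokernel_of_def Hom_def)
  let ?f = "ker C N q" and ?g = "coker C N i"
  note f = ker_in_Hom[OF q] and g = coker_in_Hom[OF i]
  have XZ: "Dom C ?f = Ker C N q" "Cod C ?g = Coker C N i" using f g by (auto simp: Hom_def)
  have ns: "null_sequence C N ?f ?g" using f g null by (auto simp: null_sequence_def Hom_def)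
  let ?s = "sigma C N ?f ?g" and ?t = "tau C N ?f ?g" and ?m = "canonical_map C N ?f ?g"
  note s = sigma_in_Hom(1)[OF ns, unfolded XZ] and t = tau_in_Hom(1)[OF ns, unfolded XZ]
  note cs = coker_in_Hom[OF s] and kt = ker_in_Hom[OF t]
  \<comment> \<open>For this sequence, ker \<open>?g\<close> and coker \<open>?f\<close> recover
    \<open>i\<close> and \<open>q\<close> only up to the isomorphisms \<open>a\<close> and
    \<open>b\<close>, which must be carried along.\<close>
  obtain a where a: "is_iso C A (Ker C N ?g) a" "ker C N ?g \<cdot> a = i"
    using is_kernel_iso_ker_coker[OF ik i] .
  obtain b where b: "is_iso C (Coker C N ?f) D b" "b \<cdot> coker C N ?f = q"
    using is_cokernel_iso_coker_ker[OF qc q] .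
  have m: "is_iso C (Coker C N ?s) (Ker C N ?t) ?m"
    using iso[OF ns] by (simp add: left_homology_def right_homology_def)
  have aH: "a \<in> Hom C A (Ker C N ?g)" and bH: "b \<in> Hom C (Coker C N ?f) D"
    and mH: "?m \<in> Hom C (Coker C N ?s) (Ker C N ?t)"
    using a b m by (auto simp: is_iso_def)
  \<comment> \<open>The middle object will be Ker \<tau>. The maps \<open>a\<close> and
    \<open>?m\<close> are absorbed into the cokernel part, and \<open>b\<close> into the kernel
    part.\<close>
  have p: "is_cokernel C N (coker C N ?s \<cdot> a)" "coker C N ?s \<cdot> a \<in> Hom C A (Coker C N ?s)"
    using cokernel_Comp[OF iso_is_cokernel[OF a(1)] is_cokernel_coker[OF s]] aH cs
      Comp_in_Hom[OF aH cs] by (auto simp: Hom_def)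
  have \<pi>: "is_cokernel C N (?m \<cdot> coker C N ?s \<cdot> a)" "?m \<cdot> coker C N ?s \<cdot> a \<in> Hom C A (Ker C N ?t)"
    using cokernel_Comp[OF p(1) iso_is_cokernel[OF m]] p mH Comp_in_Hom[OF p(2) mH]
    by (auto simp: Hom_def)
  have \<iota>: "is_kernel C N (b \<cdot> ker C N ?t)" "b \<cdot> ker C N ?t \<in> Hom C (Ker C N ?t) D"
    using kernel_Comp[OF is_kernel_ker[OF t] iso_is_kernel[OF b(1)]] bH kt
      Comp_in_Hom[OF kt bH] by (auto simp: Hom_def)
  note cf = coker_in_Hom[OF f] and kg = ker_in_Hom[OF g]
  have "q \<cdot> i = b \<cdot> (coker C N ?f \<cdot> ker C N ?g) \<cdot> a"
    using Comp_assoc[OF i cf bH] Comp_assoc[OF aH kg cf] a(2) b(2) by simp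
  also have "\<dots> = b \<cdot> (ker C N ?t \<cdot> ?m \<cdot> coker C N ?s) \<cdot> a"
    by (simp add: canonical_map_factorization[OF ns])
  also have "\<dots> = (b \<cdot> ker C N ?t) \<cdot> ?m \<cdot> coker C N ?s \<cdot> a"
    using Comp_assoc[OF aH Comp_in_Hom[OF cs mH] kt] Comp_assoc[OF aH cs mH]
      Comp_assoc[OF \<pi>(2) kt bH] by simp
  finally show "\<exists>H \<pi> \<iota>. \<pi> \<in> Hom C (Dom C i) H \<and> is_cokernel C N \<pi> \<and>
      \<iota> \<in> Hom C H (Cod C q) \<and> is_kernel C N \<iota> \<and> q \<cdot> i = \<iota> \<cdot> \<pi>"
    using \<pi> \<iota> by (auto simp: A D)
qed

theorem theorem1:
  fixes C :: "('o, 'm) cat" and N :: "'m set"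
  assumes "ex2_category C N"
  shows "homological_category C N \<longleftrightarrow>
    (\<forall>f g. null_sequence C N f g \<longrightarrow>
       is_iso C (left_homology C N f g) (right_homology C N f g) (canonical_map C N f g))"
proof (intro iffI allI impI)
  fix f g
  assume "homological_category C N" and "null_sequence C N f g"
  then show "is_iso C (left_homology C N f g) (right_homology C N f g) (canonical_map C N f g)"
    by (rule homological_category.canonical_map_iso)
next
  assume "\<forall>f g. null_sequence C N f g \<longrightarrow>
    is_iso C (left_homology C N f g) (right_homology C N f g) (canonical_map C N f g)"
  then show "homological_category C N"
    by (intro ex2_category.homological_if_canonical_map_iso[OF assms]) simp
qed

end
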